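(* Let $M$ be a monoid. Then the augmentation ideal $\ell^{1}_{0}(M)$ is finitely-generated as a left ideal of $\ell^{1}(M)$ if and only if $M$ is pseudo-finite.
   Context: A monoid is a semigroup with an identity element $e$. $\ell^1(M)$ is the set of $f:M\to\mathbb{C}$ with $\|f\|=\sum_{u\in M}|f(u)|<\infty$, a unital Banach algebra under convolution $(f*g)(u)=\sum_{st=u}f(s)g(t)$. The augmentation ideal is $\ell^1_0(M)=\{f\in\ell^1(M):\sum_{u\in M}f(u)=0\}$. A left ideal $I$ of a unital algebra $A$ is finitely-generated if there exist $n\in\mathbb{N}$ and $x_1,\ldots,x_n\in A$ with $I=Ax_1+\cdots+Ax_n$ (purely algebraically, no closure is taken). For $E\subset M$ and $x\in M$ write $E\cdot x=\{ux:u\in E\}$ and $E\cdot x^{-1}=\{u\in M: ux\in E\}$ ($x$ need not be invertible). Write also $u\cdot x^{\pm1}=\{u\}\cdot x^{\pm 1}$. Given $X\subset M$, set $B_0=\{e\}$ and, for $n\in\mathbb{N}$, $$B_n=\{e\}\cup\bigcup_{k\le n,\;x_1,\ldots,x_k\in X}\ \bigcup_{(\varepsilon_1,\ldots,\varepsilon_k)\in\{\pm1\}^k}\bigl(\ldots((e\cdot x_1^{\varepsilon_1})\cdot x_2^{\varepsilon_2})\cdot\ldots\cdot x_k^{\varepsilon_k}\bigr).$$ The monoid $M$ is pseudo-finite if there exist $n\in\mathbb{N}$ and a finite subset $X$ of $M$ such that $M=\bigcup_{k=0}^n B_k$, where the sets $B_k$ are defined with respect to $X$. *)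

theory Defs
  imports "HOL-Analysis.Infinite_Sum"
begin

section \<open>The algebra \<open>\<ell>\<^sup>1(M)\<close>\<close>

text \<open>The monoid \<open>M\<close> is a type \<open>'a\<close> of class \<^class>\<open>monoid_mult\<close> (not necessarily countable); its identity
  element is \<open>1\<close>.\<close>

typedef 'a l1 = "{f :: 'a \<Rightarrow> complex. f abs_summable_on UNIV}"
  morphisms l1_apply Abs_l1
  by (rule exI[of _ "\<lambda>_. 0"]) simp

setup_lifting type_definition_l1

lemma l1_apply_abs_summable: "l1_apply f abs_summable_on A"
proof -
  have "l1_apply f abs_summable_on UNIV"
    using l1_apply[of f] by simp
  then show ?thesis
    by (rule summable_on_subset_banach) simp
qed

definition convolution ::
    "('a::monoid_mult \<Rightarrow> complex) \<Rightarrow> ('a \<Rightarrow> complex) \<Rightarrow> 'a \<Rightarrow> complex" where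
  "convolution f g u = (\<Sum>\<^sub>\<infinity>(s, t)\<in>{(s, t). s * t = u}. f s * g t)"

text \<open>Convolution is the push-forward of the tensor product along multiplication, which reduces
  summability and associativity to two general facts on push-forwards.\<close>

definition pushf :: "('b \<Rightarrow> 'c) \<Rightarrow> ('b \<Rightarrow> complex) \<Rightarrow> 'c \<Rightarrow> complex" where
  "pushf p h u = (\<Sum>\<^sub>\<infinity>x\<in>{x. p x = u}. h x)"

definition tensor :: "('b \<Rightarrow> complex) \<Rightarrow> ('c \<Rightarrow> complex) \<Rightarrow> 'b \<times> 'c \<Rightarrow> complex" where
  "tensor f g = (\<lambda>(s, t). f s * g t)"

lemma convolution_eq_pushf: "convolution f g = pushf (\<lambda>(s, t). s * t) (tensor f g)"
  by (auto simp: convolution_def pushf_def tensor_def fun_eq_iff case_prod_unfold)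

lemma tensor_abs_summable:
  assumes "f abs_summable_on UNIV" "g abs_summable_on UNIV"
  shows "tensor f g abs_summable_on UNIV"
proof -
  have "tensor f g abs_summable_on (Sigma UNIV (\<lambda>_. UNIV))"
    unfolding abs_summable_on_Sigma_iff tensor_def using assms
    by (auto simp: norm_mult infsum_cmult_right' abs_mult
        intro!: summable_on_cmult_right summable_on_cmult_left)
  then show ?thesis by simp
qed

lemma summable_fibres:
  fixes h :: "'b \<Rightarrow> 'd::banach"
  assumes "h summable_on UNIV"
  shows "(\<lambda>(u, x). h x) summable_on Sigma A (\<lambda>u. {x. p x = u})"
    and "(\<Sum>\<^sub>\<infinity>(u, x)\<in>Sigma A (\<lambda>u. {x. p x = u}). h x) = (\<Sum>\<^sub>\<infinity>x\<in>{x. p x \<in> A}. h x)"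
proof -
  have "h summable_on {x. p x \<in> A}"
    using assms by (rule summable_on_subset_banach) simp
  moreover have "(\<lambda>(u, x). h x) summable_on Sigma A (\<lambda>u. {x. p x = u})
      \<longleftrightarrow> h summable_on {x. p x \<in> A}"
    by (rule summable_on_reindex_bij_witness[where i = "\<lambda>x. (p x, x)" and j = snd]) auto
  ultimately show "(\<lambda>(u, x). h x) summable_on Sigma A (\<lambda>u. {x. p x = u})" by simp
  show "(\<Sum>\<^sub>\<infinity>(u, x)\<in>Sigma A (\<lambda>u. {x. p x = u}). h x) = (\<Sum>\<^sub>\<infinity>x\<in>{x. p x \<in> A}. h x)"
    by (rule infsum_reindex_bij_witness[where i = "\<lambda>x. (p x, x)" and j = snd]) auto
qed

lemma pushf_abs_summable:
  assumes "h abs_summable_on UNIV"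
  shows "pushf p h abs_summable_on UNIV"
proof -
  have "(\<lambda>(u, x). norm (h x)) summable_on Sigma UNIV (\<lambda>u. {x. p x = u})"
    using summable_fibres(1)[OF assms] .
  then have "(\<lambda>(u, x). h x) abs_summable_on Sigma UNIV (\<lambda>u. {x. p x = u})"
    by (simp add: case_prod_unfold)
  then have "(\<lambda>u. \<Sum>\<^sub>\<infinity>x\<in>{x. p x = u}. norm (h x)) abs_summable_on UNIV"
    by (simp add: abs_summable_on_Sigma_iff)
  then show ?thesis
  proof (rule abs_summable_on_comparison_test)
    fix u
    have "norm (pushf p h u) \<le> (\<Sum>\<^sub>\<infinity>x\<in>{x. p x = u}. norm (h x))"
      unfolding pushf_def
      by (rule norm_infsum_bound) (rule summable_on_subset_banach[OF assms], simp)
    then show "norm (pushf p h u) \<le> norm (\<Sum>\<^sub>\<infinity>x\<in>{x. p x = u}. norm (h x))"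
      by simp
  qed
qed

lemma pushf_pushf:
  assumes "h abs_summable_on UNIV"
  shows "pushf q (pushf p h) = pushf (\<lambda>x. q (p x)) h"
proof
  fix v
  note sm = abs_summable_summable[OF assms]
  have "pushf q (pushf p h) v = (\<Sum>\<^sub>\<infinity>u\<in>{u. q u = v}. \<Sum>\<^sub>\<infinity>x\<in>{x. p x = u}. h x)"
    by (simp add: pushf_def)
  also have "\<dots> = (\<Sum>\<^sub>\<infinity>(u, x)\<in>Sigma {u. q u = v} (\<lambda>u. {x. p x = u}). h x)"
    by (rule infsum_Sigma'_banach[OF summable_fibres(1)[OF sm]])
  also have "\<dots> = pushf (\<lambda>x. q (p x)) h v"
    unfolding summable_fibres(2)[OF sm] by (simp add: pushf_def)
  finally show "pushf q (pushf p h) v = pushf (\<lambda>x. q (p x)) h v" .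
qed

lemma tensor_pushf_left:
  fixes p :: "'b \<Rightarrow> 'c" and k :: "'d \<Rightarrow> complex"
  shows "tensor (pushf p h) k = pushf (\<lambda>(x, y). (p x, y)) (tensor h k)"
proof
  fix z :: "'c \<times> 'd"
  obtain a b where z: "z = (a, b)" by (cases z)
  have "tensor (pushf p h) k z = (\<Sum>\<^sub>\<infinity>x\<in>{x. p x = a}. h x * k b)"
    by (simp add: z tensor_def pushf_def infsum_cmult_left')
  also have "\<dots> = pushf (\<lambda>(x, y). (p x, y)) (tensor h k) z"
    unfolding pushf_def tensor_def z
    by (rule infsum_reindex_bij_witness[where j = "\<lambda>x. (x, b)" and i = fst]) auto
  finally show "tensor (pushf p h) k z = pushf (\<lambda>(x, y). (p x, y)) (tensor h k) z" .
qed

lemma tensor_pushf_right: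
  fixes p :: "'c \<Rightarrow> 'd" and k :: "'b \<Rightarrow> complex"
  shows "tensor k (pushf p h) = pushf (\<lambda>(y, x). (y, p x)) (tensor k h)"
proof
  fix z :: "'b \<times> 'd"
  obtain b a where z: "z = (b, a)" by (cases z)
  have "tensor k (pushf p h) z = (\<Sum>\<^sub>\<infinity>x\<in>{x. p x = a}. k b * h x)"
    by (simp add: z tensor_def pushf_def infsum_cmult_right')
  also have "\<dots> = pushf (\<lambda>(y, x). (y, p x)) (tensor k h) z"
    unfolding pushf_def tensor_def z
    by (rule infsum_reindex_bij_witness[where j = "\<lambda>x. (b, x)" and i = snd]) auto
  finally show "tensor k (pushf p h) z = pushf (\<lambda>(y, x). (y, p x)) (tensor k h) z" .
qed

lemma convolution_abs_summable:
  assumes "f abs_summable_on UNIV" "g abs_summable_on UNIV"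
  shows "convolution f g abs_summable_on UNIV"
  unfolding convolution_eq_pushf by (intro pushf_abs_summable tensor_abs_summable assms)

lemma convolution_assoc:
  assumes "f abs_summable_on UNIV" "g abs_summable_on UNIV" "h abs_summable_on UNIV"
  shows "convolution (convolution f g) h = convolution f (convolution g h)"
proof -
  have "convolution (convolution f g) h
      = pushf (\<lambda>((r, s), t). r * s * t) (tensor (tensor f g) h)"
    unfolding convolution_eq_pushf tensor_pushf_left
    by (subst pushf_pushf) (auto intro!: tensor_abs_summable assms simp: case_prod_unfold)
  also have "\<dots> = pushf (\<lambda>(r, (s, t)). r * (s * t)) (tensor f (tensor g h))"
    unfolding pushf_def tensor_def
    by (rule ext, rule infsum_reindex_bij_witness[where
          j = "\<lambda>((r, s), t). (r, (s, t))" and i = "\<lambda>(r, (s, t)). ((r, s), t)"])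
      (auto simp: mult.assoc)
  also have "\<dots> = convolution f (convolution g h)"
    unfolding convolution_eq_pushf tensor_pushf_right
    by (subst pushf_pushf) (auto intro!: tensor_abs_summable assms simp: case_prod_unfold)
  finally show ?thesis .
qed

lemma convolution_summable:
  fixes f g :: "'a \<Rightarrow> complex"
  assumes "f abs_summable_on UNIV" "g abs_summable_on UNIV"
  shows "(\<lambda>(s, t). f s * g t) summable_on A"
  using abs_summable_summable[OF tensor_abs_summable[OF assms]]
  unfolding tensor_def by (rule summable_on_subset_banach) simp

lemma abs_summable_add:
  fixes f g :: "'a \<Rightarrow> complex"
  assumes "f abs_summable_on UNIV" "g abs_summable_on UNIV"
  shows "(\<lambda>u. f u + g u) abs_summable_on UNIV"
proof (rule abs_summable_on_comparison_test)
  show "(\<lambda>u. norm (f u) + norm (g u)) abs_summable_on UNIV"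
    using summable_on_add[OF assms] by simp
  show "norm (f u + g u) \<le> norm (norm (f u) + norm (g u))" for u
    using norm_triangle_ineq[of "f u" "g u"] by simp
qed

instantiation l1 :: (monoid_mult) ring_1
begin

lift_definition zero_l1 :: "'a l1" is "\<lambda>_. 0"
  by simp

lift_definition one_l1 :: "'a l1" is "\<lambda>u. if u = 1 then 1 else 0"
proof -
  have "(\<lambda>u::'a. norm (if u = 1 then 1 else 0 :: complex)) summable_on UNIV
      \<longleftrightarrow> (\<lambda>u::'a. norm (if u = 1 then 1 else 0 :: complex)) summable_on {1}"
    by (rule summable_on_cong_neutral) auto
  then show "(\<lambda>u::'a. if u = 1 then 1 else 0 :: complex) abs_summable_on UNIV" by simp
qed

lift_definition plus_l1 :: "'a l1 \<Rightarrow> 'a l1 \<Rightarrow> 'a l1" is "\<lambda>f g u. f u + g u"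
  by (rule abs_summable_add)

lift_definition uminus_l1 :: "'a l1 \<Rightarrow> 'a l1" is "\<lambda>f u. - f u"
  by simp

lift_definition minus_l1 :: "'a l1 \<Rightarrow> 'a l1 \<Rightarrow> 'a l1" is "\<lambda>f g u. f u - g u"
proof -
  fix f g :: "'a \<Rightarrow> complex"
  assume "f abs_summable_on UNIV" "g abs_summable_on UNIV"
  then show "(\<lambda>u. f u - g u) abs_summable_on UNIV"
    using abs_summable_add[of f "\<lambda>u. - g u"] by simp
qed

lift_definition times_l1 :: "'a l1 \<Rightarrow> 'a l1 \<Rightarrow> 'a l1" is convolution
  by (rule convolution_abs_summable)

instance
proof
  fix f g h :: "'a l1"
  show "f * g * h = f * (g * h)"
    by transfer (rule convolution_assoc)
  show "1 * f = f"
  proof (transfer, rule ext)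
    fix f :: "'a \<Rightarrow> complex" and u
    have "convolution (\<lambda>u. if u = 1 then 1 else 0) f u
        = (\<Sum>\<^sub>\<infinity>(s, t)\<in>{(1 :: 'a, u)}. (if s = 1 then 1 else 0) * f t)"
      unfolding convolution_def by (rule infsum_cong_neutral) (auto split: if_splits)
    then show "convolution (\<lambda>u. if u = 1 then 1 else 0) f u = f u" by simp
  qed
  show "f * 1 = f"
  proof (transfer, rule ext)
    fix f :: "'a \<Rightarrow> complex" and u
    have "convolution f (\<lambda>u. if u = 1 then 1 else 0) u
        = (\<Sum>\<^sub>\<infinity>(s, t)\<in>{(u, 1 :: 'a)}. f s * (if t = 1 then 1 else 0))"
      unfolding convolution_def by (rule infsum_cong_neutral) (auto split: if_splits)
    then show "convolution f (\<lambda>u. if u = 1 then 1 else 0) u = f u" by simp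
  qed
  show "(f + g) * h = f * h + g * h"
  proof (transfer, rule ext)
    fix f g h :: "'a \<Rightarrow> complex" and u
    assume "f abs_summable_on UNIV" "g abs_summable_on UNIV" "h abs_summable_on UNIV"
    then show "convolution (\<lambda>u. f u + g u) h u = convolution f h u + convolution g h u"
      unfolding convolution_def
      by (subst infsum_add[symmetric])
        (auto intro!: convolution_summable infsum_cong simp: algebra_simps)
  qed
  show "f * (g + h) = f * g + f * h"
  proof (transfer, rule ext)
    fix f g h :: "'a \<Rightarrow> complex" and u
    assume "f abs_summable_on UNIV" "g abs_summable_on UNIV" "h abs_summable_on UNIV"
    then show "convolution f (\<lambda>u. g u + h u) u = convolution f g u + convolution f h u"
      unfolding convolution_def
      by (subst infsum_add[symmetric])
        (auto intro!: convolution_summable infsum_cong simp: algebra_simps)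
  qed
  show "(0::'a l1) \<noteq> 1"
    by transfer (auto simp: fun_eq_iff)
qed (transfer; auto simp: fun_eq_iff)+

end

definition augmentation_ideal :: "'a::monoid_mult l1 set" where
  "augmentation_ideal = {f. (\<Sum>\<^sub>\<infinity>u. l1_apply f u) = 0}"

text \<open>\<open>I = A x\<^sub>1 + \<dots> + A x\<^sub>n\<close>, without any closure; the empty sum gives the zero ideal.\<close>

definition finitely_generated_left_ideal :: "'r::ring_1 set \<Rightarrow> bool" where
  "finitely_generated_left_ideal I \<longleftrightarrow>
    (\<exists>(n::nat) x. I = {\<Sum>i=1..n. a i * x i | a :: nat \<Rightarrow> 'r. True})"


section \<open>Pseudo-finite monoids\<close>

definition right_translate :: "'a::monoid_mult set \<Rightarrow> 'a \<Rightarrow> 'a set" where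
  "right_translate E x = {u * x | u. u \<in> E}"

definition right_preimage :: "'a::monoid_mult set \<Rightarrow> 'a \<Rightarrow> 'a set" where
  "right_preimage E x = {u. u * x \<in> E}"

text \<open>\<open>E \<cdot> x\<^sup>\<epsilon>\<close>, where the exponent \<open>\<epsilon>\<close> is only ever \<open>1\<close> or \<open>-1\<close>.\<close>

definition signed_translate :: "'a::monoid_mult set \<Rightarrow> 'a \<times> int \<Rightarrow> 'a set" where
  "signed_translate E = (\<lambda>(x, \<epsilon>). if \<epsilon> = 1 then right_translate E x else right_preimage E x)"

text \<open>The list \<open>w = [(x\<^sub>1, \<epsilon>\<^sub>1), \<dots>, (x\<^sub>k, \<epsilon>\<^sub>k)]\<close> encodes
  \<open>(\<dots>((e \<cdot> x\<^sub>1\<^sup>\<epsilon>\<^sub>1) \<cdot> x\<^sub>2\<^sup>\<epsilon>\<^sub>2) \<dots>) \<cdot> x\<^sub>k\<^sup>\<epsilon>\<^sub>k\<close>.\<close>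

definition Bset :: "'a::monoid_mult set \<Rightarrow> nat \<Rightarrow> 'a set" where
  "Bset X n = {1} \<union>
    (\<Union>w\<in>{w. length w \<le> n \<and> set w \<subseteq> X \<times> {1, -1}}. foldl signed_translate {1} w)"

definition pseudo_finite :: "'a::monoid_mult itself \<Rightarrow> bool" where
  "pseudo_finite M \<longleftrightarrow>
    (\<exists>(n::nat) (X :: 'a set). finite X \<and> (UNIV :: 'a set) = (\<Union>k\<in>{0..n}. Bset X k))"

end

theory Submission
  imports Defs
begin

text \<open>Write \<open>\<delta>\<^sub>x\<close> for the point mass at \<open>x\<close> and, for \<open>f \<in> \<ell>\<^sup>1(M)\<close>, let the collapse of \<open>f\<close> be
  \<open>(\<Sum>\<^sub>u f(u)) \<delta>\<^sub>1\<close>, the push-forward of \<open>f\<close> along the constant map \<open>u \<mapsto> 1\<close>. The augmentation ideal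
  is the kernel of the collapse.

  Suppose that \<open>M\<close> is pseudo-finite with respect to the finite set \<open>X\<close>, and let \<open>J\<close> be the left ideal
  generated by the elements \<open>1 - \<delta>\<^sub>x\<close> with \<open>x \<in> X\<close>. Modulo \<open>J\<close>, all the mass of \<open>f\<close> can be moved
  simultaneously one step along the right multiplication by \<open>x\<close>, because
  \<open>f - f \<delta>\<^sub>x = f (1 - \<delta>\<^sub>x)\<close>; it can also be moved one step backwards, by choosing a preimage for each
  point of the support. Hence, if every element of \<open>\<ell>\<^sup>1\<close> supported on \<open>E\<close> agrees modulo \<open>J\<close> with its
  collapse, the same is true for \<open>E \<cdot> x\<close> and for \<open>E \<cdot> x\<^sup>-\<^sup>1\<close>. Starting from \<open>{1}\<close> one reaches each of
  the finitely many sets whose union is \<open>M\<close>, so every \<open>f\<close> of total mass zero is in \<open>J\<close>.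

  Suppose conversely that \<open>x\<^sub>1, \<dots>, x\<^sub>n\<close> generate the augmentation ideal. The \<open>x\<^sub>i\<close> may have infinite
  support, and rather than replacing them by finitely supported generators with the open mapping
  theorem, the argument uses a metric adapted to them. Exhaust \<open>\<Sum>\<^sub>i \<bar>x\<^sub>i\<bar>\<close> by finite sets
  \<open>X\<^sub>0 \<subseteq> X\<^sub>1 \<subseteq> \<dots>\<close> such that the mass outside \<open>X\<^sub>k\<close> is at most \<open>2\<^sup>-\<^sup>k\<close>, let \<open>D\<^sub>k\<close> be the set \<open>B\<^sub>k\<close>
  formed with respect to \<open>X\<^sub>k\<close>, and let \<open>\<phi>\<^sub>N(u)\<close> be the number of \<open>k < N\<close> with \<open>u \<notin> D\<^sub>k\<close>, a truncated
  distance from the identity. Then \<open>\<bar>\<phi>\<^sub>N(s t) - \<phi>\<^sub>N(s)\<bar> \<le> 1 + card {k < N. t \<notin> X\<^sub>k}\<close>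
  (\<open>level_Bset_times\<close>), and the right-hand side has a bounded integral against \<open>\<Sum>\<^sub>i \<bar>x\<^sub>i\<bar>\<close>,
  uniformly in \<open>N\<close>. As each \<open>x\<^sub>i\<close> has total mass zero, it follows that for a fixed element \<open>f\<close> of the
  ideal the pairings \<open>\<langle>\<phi>\<^sub>N, f\<rangle>\<close> are bounded in \<open>N\<close> (\<open>levels_bounded_on_ideal\<close>). If \<open>M\<close> is not
  pseudo-finite, there are \<open>u\<^sub>j \<notin> D\<^bsub>4^j\<^esub>\<close>, and \<open>\<Sum>\<^sub>j 2\<^sup>-\<^sup>j (\<delta>\<^bsub>u\<^sub>j\<^esub> - 1)\<close> is in the augmentation ideal
  but has unbounded pairings.\<close>

section \<open>Push-forwards and multiplication by point masses\<close>

lift_definition push :: "('b \<Rightarrow> 'c) \<Rightarrow> 'b l1 \<Rightarrow> 'c l1" is pushf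
  by (rule pushf_abs_summable)

lift_definition point_mass :: "'b \<Rightarrow> 'b l1" is "\<lambda>x u. if u = x then 1 else 0"
proof -
  fix x :: 'b
  have "(\<lambda>u. norm (if u = x then 1 else 0 :: complex)) summable_on UNIV
      \<longleftrightarrow> (\<lambda>u. norm (if u = x then 1 else 0 :: complex)) summable_on {x}"
    by (rule summable_on_cong_neutral) auto
  then show "(\<lambda>u. if u = x then 1 else 0 :: complex) abs_summable_on UNIV" by simp
qed

lift_definition restrict_l1 :: "'b set \<Rightarrow> 'b l1 \<Rightarrow> 'b l1" is "\<lambda>A f u. if u \<in> A then f u else 0"
  by (erule abs_summable_on_comparison_test) auto

definition supported :: "'b set \<Rightarrow> 'b l1 \<Rightarrow> bool" where
  "supported E f \<longleftrightarrow> (\<forall>u. l1_apply f u \<noteq> 0 \<longrightarrow> u \<in> E)"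

lemma push_push: "push q (push p f) = push (\<lambda>x. q (p x)) f"
  by transfer (rule pushf_pushf)

lemma push_cong:
  assumes "supported E f" and "\<And>u. u \<in> E \<Longrightarrow> p u = q u"
  shows "push p f = push q f"
proof -
  have "pushf p (l1_apply f) = pushf q (l1_apply f)"
    unfolding pushf_def
    by (rule ext, rule infsum_cong_neutral) (use assms in \<open>auto simp: supported_def\<close>)
  then show ?thesis
    by (metis l1_apply_inject push.rep_eq)
qed

lemma push_ident: "push (\<lambda>u. u) f = f"
  by transfer (simp add: pushf_def fun_eq_iff)

lemma push_add: "push p (f + g) = push p f + push p g"
proof (transfer, rule ext)
  fix p :: "'b \<Rightarrow> 'a" and f g :: "'b \<Rightarrow> complex" and u
  assume fg: "f abs_summable_on UNIV" "g abs_summable_on UNIV"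
  have "f summable_on {x. p x = u}" "g summable_on {x. p x = u}"
    using fg[THEN abs_summable_summable] by (auto intro: summable_on_subset_banach)
  then show "pushf p (\<lambda>u. f u + g u) u = pushf p f u + pushf p g u"
    by (simp add: pushf_def infsum_add)
qed

lemma push_diff: "push p (f - g) = push p f - push p g"
  using push_add[of p "f - g" g] by (simp add: algebra_simps)

lemma supported_push:
  assumes "supported E f" and "\<And>u. u \<in> E \<Longrightarrow> p u \<in> E'"
  shows "supported E' (push p f)"
proof -
  have "pushf p (l1_apply f) v = 0" if "v \<notin> E'" for v
    unfolding pushf_def by (rule infsum_0) (use assms that in \<open>auto simp: supported_def\<close>)
  then show ?thesis
    by (auto simp: supported_def push.rep_eq)
qed

lemma times_point_mass: "f * point_mass x = push (\<lambda>s. s * x) f"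
proof (transfer, rule ext)
  fix f :: "'a \<Rightarrow> complex" and x u
  have "convolution f (\<lambda>u. if u = x then 1 else 0) u
      = (\<Sum>\<^sub>\<infinity>(s, t)\<in>{(s, t). s * t = u \<and> t = x}. f s)"
    unfolding convolution_def by (rule infsum_cong_neutral) (auto split: if_splits)
  also have "\<dots> = pushf (\<lambda>s. s * x) f u"
    unfolding pushf_def
    by (rule infsum_reindex_bij_witness[where i = "\<lambda>s. (s, x)" and j = fst]) auto
  finally show "convolution f (\<lambda>u. if u = x then 1 else 0) u = pushf (\<lambda>s. s * x) f u" .
qed

section \<open>Collapsing mass onto the identity\<close>

definition collapse :: "'a::monoid_mult l1 \<Rightarrow> 'a l1" where
  "collapse = push (\<lambda>_. 1)"

lemma collapse_push: "collapse (push p f) = collapse f"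
  by (simp add: collapse_def push_push)

lemma collapse_add: "collapse (f + g) = collapse f + collapse g"
  by (simp add: collapse_def push_add)

lemma collapse_diff: "collapse (f - g) = collapse f - collapse g"
  by (simp add: collapse_def push_diff)

lemma collapse_idem: "collapse (collapse f) = collapse f"
  by (simp add: collapse_def push_push)

lemma augmentation_ideal_iff: "f \<in> augmentation_ideal \<longleftrightarrow> collapse f = 0"
proof -
  have "l1_apply (collapse f) u = (if u = 1 then \<Sum>\<^sub>\<infinity>v. l1_apply f v else 0)" for u
    by (auto simp: collapse_def push.rep_eq pushf_def)
  then show ?thesis
    by (auto simp: augmentation_ideal_def l1_apply_inject[symmetric] fun_eq_iff zero_l1.rep_eq)
qed

lemma collapse_times_generator: "collapse (a * (1 - point_mass x)) = 0"
  by (simp add: right_diff_distrib times_point_mass collapse_diff collapse_push)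

section \<open>Pseudo-finite monoids have a finitely generated augmentation ideal\<close>

definition left_span :: "(nat \<Rightarrow> 'r::ring_1) \<Rightarrow> nat \<Rightarrow> 'r set" where
  "left_span x n = {\<Sum>i=1..n. a i * x i | a. True}"

lemma left_span_add:
  assumes "f \<in> left_span x n" "g \<in> left_span x n"
  shows "f + g \<in> left_span x n"
proof -
  obtain a b where "f = (\<Sum>i=1..n. a i * x i)" "g = (\<Sum>i=1..n. b i * x i)"
    using assms by (auto simp: left_span_def)
  then have "f + g = (\<Sum>i=1..n. (a i + b i) * x i)"
    by (simp add: sum.distrib distrib_right)
  then show ?thesis by (auto simp: left_span_def intro!: exI[of _ "\<lambda>i. a i + b i"])
qed

lemma left_span_zero: "0 \<in> left_span x n"
  by (auto simp: left_span_def intro!: exI[of _ "\<lambda>_. 0"])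

lemma left_span_times_generator:
  assumes "i \<in> {1..n}"
  shows "a * x i \<in> left_span x n"
proof -
  have "a * x i = (\<Sum>j=1..n. (if j = i then a else 0) * x j)"
    using assms by (simp add: if_distrib[of "\<lambda>c. c * _"] cong: if_cong)
  then show ?thesis by (auto simp: left_span_def intro!: exI[of _ "\<lambda>j. if j = i then a else 0"])
qed

text \<open>The invariant for the passage from \<open>{1}\<close> to \<open>M\<close>. In the application \<open>J\<close> is a left ideal;
  speaking of all elements supported on \<open>E\<close>, and not only of the point masses \<open>\<delta>\<^sub>u\<close> with \<open>u \<in> E\<close>,
  makes norm estimates for infinite sums over \<open>E\<close> superfluous.\<close>

definition collapsible :: "'a::monoid_mult l1 set \<Rightarrow> 'a set \<Rightarrow> bool" where
  "collapsible J E \<longleftrightarrow> (\<forall>f. supported E f \<longrightarrow> f - collapse f \<in> J)"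

context
  fixes J :: "'a::monoid_mult l1 set"
  assumes J_zero: "0 \<in> J"
    and J_add: "\<And>f g. f \<in> J \<Longrightarrow> g \<in> J \<Longrightarrow> f + g \<in> J"
begin

lemma collapsible_identity: "collapsible J {1}"
proof -
  have "f - collapse f = 0" if "supported {1} f" for f :: "'a l1"
    using push_cong[OF that, of "\<lambda>u. u" "\<lambda>_. 1"] by (simp add: push_ident collapse_def)
  then show ?thesis using J_zero by (simp add: collapsible_def)
qed

lemma collapsible_Un:
  assumes "collapsible J A" "collapsible J B"
  shows "collapsible J (A \<union> B)"
  unfolding collapsible_def
proof (intro allI impI)
  fix f assume f: "supported (A \<union> B) f"
  define g where "g = restrict_l1 A f"
  define h where "h = restrict_l1 (- A) f"
  have fgh: "f = g + h"
    unfolding g_def h_def by transfer auto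
  have "supported A g" "supported B h"
    using f by (auto simp: supported_def g_def h_def restrict_l1.rep_eq split: if_splits)
  then have "(g - collapse g) + (h - collapse h) \<in> J"
    using assms by (auto simp: collapsible_def intro: J_add)
  then show "f - collapse f \<in> J"
    by (simp add: fgh collapse_add algebra_simps)
qed

lemma collapsible_empty: "collapsible J {}"
  using collapsible_identity by (auto simp: collapsible_def supported_def)

lemma collapsible_UN:
  "finite W \<Longrightarrow> (\<And>w. w \<in> W \<Longrightarrow> collapsible J (E w)) \<Longrightarrow> collapsible J (\<Union>w\<in>W. E w)"
  by (induction W rule: finite_induct) (auto intro: collapsible_empty collapsible_Un)

text \<open>Each point of \<open>E \<cdot> x\<close> has a preimage under \<open>u \<mapsto> u x\<close> in \<open>E\<close>. Pushing \<open>f\<close> along a choice \<open>r\<close> of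
  preimages gives an element \<open>g\<close> supported on \<open>E\<close> with \<open>g \<delta>\<^sub>x = f\<close>, so \<open>f\<close> and \<open>g\<close> differ by
  an element of \<open>J\<close> and have the same collapse.\<close>

lemma collapsible_right_translate:
  assumes E: "collapsible J E" and x: "\<And>a. a * (1 - point_mass x) \<in> J"
  shows "collapsible J (right_translate E x)"
  unfolding collapsible_def
proof (intro allI impI)
  fix f assume f: "supported (right_translate E x) f"
  define r where "r v = (SOME u. u \<in> E \<and> u * x = v)" for v
  have r: "r v \<in> E \<and> r v * x = v" if "v \<in> right_translate E x" for v
    unfolding r_def by (rule someI_ex) (use that in \<open>auto simp: right_translate_def\<close>)
  define g where "g = push r f"
  have "supported E g"
    unfolding g_def using f r by (auto intro: supported_push)
  then have 1: "g - collapse g \<in> J"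
    using E by (simp add: collapsible_def)
  have "g * point_mass x = push (\<lambda>v. r v * x) f"
    by (simp add: times_point_mass g_def push_push)
  also have "\<dots> = f"
    using push_cong[OF f, of "\<lambda>v. r v * x" "\<lambda>v. v"] r by (simp add: push_ident)
  finally have gx: "g * point_mass x = f" .
  have "collapse g = collapse f"
    by (simp add: g_def collapse_push)
  then have "f - collapse f = (g - collapse g) + (- g) * (1 - point_mass x)"
    by (simp add: algebra_simps gx)
  then show "f - collapse f \<in> J"
    using J_add[OF 1 x[of "- g"]] by simp
qed

text \<open>Here no choice is involved: \<open>f \<delta>\<^sub>x\<close> is supported on \<open>E\<close> and has the same collapse as \<open>f\<close>.\<close>

lemma collapsible_right_preimage:
  assumes E: "collapsible J E" and x: "\<And>a. a * (1 - point_mass x) \<in> J"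
  shows "collapsible J (right_preimage E x)"
  unfolding collapsible_def
proof (intro allI impI)
  fix f assume f: "supported (right_preimage E x) f"
  define g where "g = f * point_mass x"
  have "supported E g"
    unfolding g_def times_point_mass using f
    by (rule supported_push) (simp add: right_preimage_def)
  then have 1: "g - collapse g \<in> J"
    using E by (simp add: collapsible_def)
  have "collapse g = collapse f"
    by (simp add: g_def times_point_mass collapse_push)
  then have "f - collapse f = (g - collapse g) + f * (1 - point_mass x)"
    by (simp add: algebra_simps g_def)
  then show "f - collapse f \<in> J"
    using J_add[OF 1 x] by simp
qed

lemma collapsible_word:
  assumes "\<And>x a. x \<in> X \<Longrightarrow> a * (1 - point_mass x) \<in> J"
  shows "set w \<subseteq> X \<times> {1, -1} \<Longrightarrow> collapsible J (foldl signed_translate {1} w)"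
proof (induction w rule: rev_induct)
  case Nil
  then show ?case by (simp add: collapsible_identity)
next
  case (snoc z w)
  obtain x \<epsilon> where z: "z = (x, \<epsilon>)" by (cases z)
  have "collapsible J (foldl signed_translate {1} w)" and "x \<in> X"
    using snoc z by auto
  then have "collapsible J (signed_translate (foldl signed_translate {1} w) z)"
    using assms unfolding z signed_translate_def prod.case
    by (auto intro: collapsible_right_translate collapsible_right_preimage)
  then show ?case by simp
qed

lemma collapsible_Bset:
  assumes "finite X" and "\<And>x a. x \<in> X \<Longrightarrow> a * (1 - point_mass x) \<in> J"
  shows "collapsible J (Bset X n)"
  unfolding Bset_def
proof (intro collapsible_Un collapsible_identity collapsible_UN)
  have "{w. length w \<le> n \<and> set w \<subseteq> X \<times> {1, - 1 :: int}}
      = {w. set w \<subseteq> X \<times> {1, - 1} \<and> length w \<le> n}" by auto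
  then show "finite {w. length w \<le> n \<and> set w \<subseteq> X \<times> {1, - 1 :: int}}"
    using finite_lists_length_le[of "X \<times> {1, - 1 :: int}" n] assms(1) by simp
qed (use collapsible_word[OF assms(2)] in auto)

end

lemma collapse_sum: "collapse (\<Sum>i\<in>I. f i) = (\<Sum>i\<in>I. collapse (f i))"
proof -
  have "collapse (0 :: 'a l1) = 0"
    using collapse_diff[of 0 "0 :: 'a l1"] by simp
  then show ?thesis
    by (induction I rule: infinite_finite_induct) (auto simp: collapse_add)
qed

lemma pseudo_finite_imp_finitely_generated:
  assumes "pseudo_finite TYPE('a::monoid_mult)"
  shows "finitely_generated_left_ideal (augmentation_ideal :: 'a l1 set)"
proof -
  obtain n and X :: "'a set" where X: "finite X" and UN: "UNIV = (\<Union>k\<in>{0..n}. Bset X k)"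
    using assms by (auto simp: pseudo_finite_def)
  obtain e where e: "bij_betw e {1..card X} X"
    using ex_bij_betw_nat_finite_1[OF X] by blast
  define y where "y i = 1 - point_mass (e i)" for i
  let ?J = "left_span y (card X)"
  have gen: "a * (1 - point_mass x) \<in> ?J" if x: "x \<in> X" for x and a :: "'a l1"
  proof -
    have "x \<in> e ` {1..card X}"
      using x bij_betw_imp_surj_on[OF e] by simp
    then obtain i where "i \<in> {1..card X}" "e i = x"
      by (elim imageE) simp
    then show ?thesis
      using left_span_times_generator[of i "card X" a y] by (simp add: y_def)
  qed
  have "collapsible ?J (\<Union>k\<in>{0..n}. Bset X k)"
    by (intro collapsible_UN collapsible_Bset left_span_add left_span_zero X gen) auto
  then have all: "f - collapse f \<in> ?J" for f
    unfolding UN[symmetric] by (simp add: collapsible_def supported_def)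
  have "augmentation_ideal = ?J"
  proof (rule set_eqI)
    fix f :: "'a l1"
    have "collapse f = 0" if "f \<in> ?J"
      using that by (auto simp: left_span_def y_def collapse_sum collapse_times_generator)
    then show "f \<in> augmentation_ideal \<longleftrightarrow> f \<in> ?J"
      using all[of f] by (auto simp: augmentation_ideal_iff)
  qed
  then show ?thesis
    unfolding finitely_generated_left_ideal_def left_span_def by blast
qed


section \<open>A finitely generated augmentation ideal forces pseudo-finiteness\<close>

definition pairing :: "('b \<Rightarrow> complex) \<Rightarrow> 'b l1 \<Rightarrow> complex" where
  "pairing \<phi> f = (\<Sum>\<^sub>\<infinity>u. \<phi> u * l1_apply f u)"

lemma bounded_times_abs_summable:
  fixes \<phi> h :: "'b \<Rightarrow> 'c::{real_normed_field,banach}"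
  assumes "\<And>x. norm (\<phi> x) \<le> C" and "h abs_summable_on A"
  shows "(\<lambda>x. \<phi> x * h x) abs_summable_on A"
proof (rule abs_summable_on_comparison_test')
  show "(\<lambda>x. C * norm (h x)) summable_on A"
    using assms(2) by (rule summable_on_cmult_right)
  show "norm (\<phi> x * h x) \<le> C * norm (h x)" for x
    by (simp add: norm_mult assms(1) mult_right_mono)
qed

text \<open>The change of variables formula for the integral of a bounded function against an image measure.
  It serves both for \<open>push\<close> and for the convolution, which is the push-forward of a tensor product.\<close>

lemma infsum_times_pushf:
  assumes \<phi>: "\<And>v. norm (\<phi> v) \<le> C" and h: "h abs_summable_on UNIV"
  shows "(\<Sum>\<^sub>\<infinity>v. \<phi> v * pushf p h v) = (\<Sum>\<^sub>\<infinity>x. \<phi> (p x) * h x)"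
proof -
  let ?k = "\<lambda>x. \<phi> (p x) * h x"
  have "\<phi> v * pushf p h v = pushf p ?k v" for v
  proof -
    have "\<phi> v * pushf p h v = (\<Sum>\<^sub>\<infinity>x\<in>{x. p x = v}. \<phi> v * h x)"
      by (simp add: pushf_def infsum_cmult_right')
    also have "\<dots> = pushf p ?k v"
      unfolding pushf_def by (rule infsum_cong) auto
    finally show ?thesis .
  qed
  then have "(\<Sum>\<^sub>\<infinity>v. \<phi> v * pushf p h v) = pushf (\<lambda>_. ()) (pushf p ?k) ()"
    by (simp add: pushf_def[of "\<lambda>_. ()"])
  also have "\<dots> = pushf (\<lambda>_. ()) ?k ()"
    using pushf_pushf[OF bounded_times_abs_summable[OF \<phi> h], of "\<lambda>_. ()" p] by simp
  finally show ?thesis by (simp add: pushf_def)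
qed

lemma pairing_push:
  assumes "\<And>v. norm (\<phi> v) \<le> C"
  shows "pairing \<phi> (push p f) = pairing (\<lambda>x. \<phi> (p x)) f"
  using infsum_times_pushf[OF assms l1_apply_abs_summable] by (simp add: pairing_def push.rep_eq)

lemma pairing_add:
  assumes "\<And>v. norm (\<phi> v) \<le> C"
  shows "pairing \<phi> (f + g) = pairing \<phi> f + pairing \<phi> g"
proof -
  have "(\<lambda>v. \<phi> v * l1_apply f v) summable_on UNIV" for f
    by (rule abs_summable_summable, rule bounded_times_abs_summable[OF assms l1_apply_abs_summable])
  then show ?thesis
    by (simp add: pairing_def plus_l1.rep_eq distrib_left infsum_add)
qed

lemma pairing_sum:
  assumes "\<And>v. norm (\<phi> v) \<le> C"
  shows "pairing \<phi> (\<Sum>i\<in>I. f i) = (\<Sum>i\<in>I. pairing \<phi> (f i))"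
proof -
  have "pairing \<phi> 0 = 0" by (simp add: pairing_def zero_l1.rep_eq)
  then show ?thesis
    by (induction I rule: infinite_finite_induct) (auto simp: pairing_add[OF assms])
qed

lemma pairing_times:
  assumes \<phi>: "\<And>v. norm (\<phi> v) \<le> C"
  shows "pairing \<phi> (a * f) = (\<Sum>\<^sub>\<infinity>s. l1_apply a s * (\<Sum>\<^sub>\<infinity>t. \<phi> (s * t) * l1_apply f t))"
proof -
  let ?k = "\<lambda>(s, t). \<phi> (s * t) * (l1_apply a s * l1_apply f t)"
  have T: "tensor (l1_apply a) (l1_apply f) abs_summable_on UNIV"
    by (intro tensor_abs_summable l1_apply_abs_summable)
  have "pairing \<phi> (a * f) = (\<Sum>\<^sub>\<infinity>z. \<phi> (case z of (s, t) \<Rightarrow> s * t) * tensor (l1_apply a) (l1_apply f) z)"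
    unfolding pairing_def times_l1.rep_eq convolution_eq_pushf
    by (rule infsum_times_pushf[OF \<phi> T])
  also have "\<dots> = (\<Sum>\<^sub>\<infinity>z\<in>Sigma UNIV (\<lambda>_. UNIV). ?k z)"
    by (simp add: tensor_def case_prod_unfold)
  also have "\<dots> = (\<Sum>\<^sub>\<infinity>s. \<Sum>\<^sub>\<infinity>t. \<phi> (s * t) * (l1_apply a s * l1_apply f t))"
  proof (rule infsum_Sigma'_banach[symmetric])
    have "(\<lambda>z. \<phi> (case z of (s, t) \<Rightarrow> s * t) * tensor (l1_apply a) (l1_apply f) z) summable_on UNIV"
      by (rule abs_summable_summable, rule bounded_times_abs_summable[OF \<phi> T])
    then show "?k summable_on Sigma UNIV (\<lambda>_. UNIV)"
      by (simp add: tensor_def case_prod_unfold)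
  qed
  also have "\<dots> = (\<Sum>\<^sub>\<infinity>s. l1_apply a s * (\<Sum>\<^sub>\<infinity>t. \<phi> (s * t) * l1_apply f t))"
    by (simp add: infsum_cmult_right'[symmetric] mult.left_commute)
  finally show ?thesis .
qed

text \<open>Since \<open>f\<close> has total mass zero, \<open>\<phi>(s t)\<close> may be replaced by \<open>\<phi>(s t) - \<phi>(s)\<close> in
  \<open>\<Sum>\<^sub>s\<^sub>,\<^sub>t \<phi>(s t) a(s) f(t)\<close>. Thus the variation of \<open>\<phi>\<close> under right multiplication controls the
  pairing with \<open>a f\<close>, however large \<open>\<phi>\<close> itself is.\<close>

lemma norm_pairing_times_le:
  assumes \<phi>: "\<And>v. norm (\<phi> v) \<le> C" and f: "f \<in> augmentation_ideal"
    and bound: "\<And>s. (\<Sum>\<^sub>\<infinity>t. norm (\<phi> (s * t) - \<phi> s) * norm (l1_apply f t)) \<le> K"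
  shows "norm (pairing \<phi> (a * f)) \<le> (\<Sum>\<^sub>\<infinity>s. norm (l1_apply a s)) * K"
proof -
  have inner: "norm (\<Sum>\<^sub>\<infinity>t. \<phi> (s * t) * l1_apply f t) \<le> K" for s
  proof -
    have 1: "(\<lambda>t. \<phi> (s * t) * l1_apply f t) summable_on UNIV"
      by (rule abs_summable_summable, rule bounded_times_abs_summable[OF \<phi> l1_apply_abs_summable])
    have 2: "(\<lambda>t. - \<phi> s * l1_apply f t) summable_on UNIV"
      by (rule summable_on_cmult_right, rule abs_summable_summable, rule l1_apply_abs_summable)
    have "(\<Sum>\<^sub>\<infinity>t. (\<phi> (s * t) - \<phi> s) * l1_apply f t)
        = (\<Sum>\<^sub>\<infinity>t. \<phi> (s * t) * l1_apply f t) + (\<Sum>\<^sub>\<infinity>t. - \<phi> s * l1_apply f t)"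
      using infsum_add[OF 1 2] by (simp add: algebra_simps)
    also have "(\<Sum>\<^sub>\<infinity>t. - \<phi> s * l1_apply f t) = 0"
      using f by (subst infsum_cmult_right') (simp add: augmentation_ideal_def)
    finally have eq: "(\<Sum>\<^sub>\<infinity>t. \<phi> (s * t) * l1_apply f t)
        = (\<Sum>\<^sub>\<infinity>t. (\<phi> (s * t) - \<phi> s) * l1_apply f t)" by simp
    have "norm (\<phi> (s * t) - \<phi> s) \<le> C + C" for t
      using norm_triangle_ineq4[of "\<phi> (s * t)" "\<phi> s"] \<phi>[of "s * t"] \<phi>[of s] by linarith
    then have "(\<lambda>t. (\<phi> (s * t) - \<phi> s) * l1_apply f t) abs_summable_on UNIV"
      by (rule bounded_times_abs_summable[OF _ l1_apply_abs_summable])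
    from norm_infsum_bound[OF this] bound[of s] show ?thesis
      unfolding eq by (simp add: norm_mult)
  qed
  have A: "(\<lambda>s. norm (l1_apply a s)) summable_on UNIV"
    by (rule l1_apply_abs_summable)
  have B: "(\<lambda>s. l1_apply a s * (\<Sum>\<^sub>\<infinity>t. \<phi> (s * t) * l1_apply f t)) abs_summable_on UNIV"
    using bounded_times_abs_summable[OF inner l1_apply_abs_summable[of a]]
    by (simp add: mult.commute)
  have "norm (pairing \<phi> (a * f))
      \<le> (\<Sum>\<^sub>\<infinity>s. norm (l1_apply a s * (\<Sum>\<^sub>\<infinity>t. \<phi> (s * t) * l1_apply f t)))"
    unfolding pairing_times[OF \<phi>] by (rule norm_infsum_bound[OF B])
  also have "\<dots> \<le> (\<Sum>\<^sub>\<infinity>s. norm (l1_apply a s) * K)"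
    by (rule infsum_mono[OF B summable_on_cmult_left[OF A]])
      (simp add: norm_mult inner mult_left_mono)
  finally show ?thesis by (simp add: infsum_cmult_left')
qed

lemma finite_exhaustion_tail_le:
  fixes F :: "'b \<Rightarrow> real"
  assumes F: "F summable_on UNIV" and nonneg: "\<And>t. 0 \<le> F t"
  obtains X where "\<And>k. finite (X k)" and "incseq X"
    and "\<And>k. (\<Sum>\<^sub>\<infinity>t\<in>- X k. F t) \<le> (1 / 2) ^ k"
proof -
  have "\<exists>Y. finite Y \<and> dist (sum F Y) (infsum F UNIV) \<le> (1 / 2) ^ k" for k :: nat
    using infsum_finite_approximation[OF F, of "(1 / 2) ^ k"] by auto
  then obtain Y where Y: "\<And>k. finite (Y k)"
    and approx: "\<And>k. dist (sum F (Y k)) (infsum F UNIV) \<le> (1 / 2) ^ k"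
    by metis
  have sm: "F summable_on A" for A
    using F by (rule summable_on_subset_banach) simp
  show ?thesis
  proof
    show "finite (\<Union>j\<le>k. Y j)" for k
      using Y by auto
    show "incseq (\<lambda>k. \<Union>j\<le>k. Y j)"
      by (rule monoI) force
    show "(\<Sum>\<^sub>\<infinity>t\<in>- (\<Union>j\<le>k. Y j). F t) \<le> (1 / 2) ^ k" for k
    proof -
      have "infsum F UNIV = sum F (Y k) + (\<Sum>\<^sub>\<infinity>t\<in>- Y k. F t)"
        using infsum_Un_disjoint[OF sm[of "Y k"] sm[of "- Y k"]] Y[of k] by simp
      then have "(\<Sum>\<^sub>\<infinity>t\<in>- Y k. F t) \<le> (1 / 2) ^ k"
        using approx[of k] by (simp add: dist_real_def)
      moreover have "(\<Sum>\<^sub>\<infinity>t\<in>- (\<Union>j\<le>k. Y j). F t) \<le> (\<Sum>\<^sub>\<infinity>t\<in>- Y k. F t)"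
        by (rule infsum_mono_neutral[OF sm sm]) (auto simp: nonneg)
      ultimately show ?thesis by linarith
    qed
  qed
qed

text \<open>The weight of \<open>t\<close> is one plus the number of sets \<open>X k\<close> that miss \<open>t\<close>. Exchanging the sums turns
  the weighted sum of \<open>F\<close> into a sum of tails, which is dominated by a geometric series. The bound
  is uniform in \<open>N\<close>.\<close>

lemma infsum_levels_le:
  fixes F :: "'b \<Rightarrow> real"
  assumes F: "F summable_on UNIV"
    and tail: "\<And>k. (\<Sum>\<^sub>\<infinity>t\<in>- X k. F t) \<le> (1 / 2) ^ k"
  shows "(\<lambda>t. real (1 + card {k. k < N \<and> t \<notin> X k}) * F t) summable_on UNIV"
    and "(\<Sum>\<^sub>\<infinity>t. real (1 + card {k. k < N \<and> t \<notin> X k}) * F t) \<le> infsum F UNIV + 2"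
proof -
  have eq: "real (1 + card {k. k < N \<and> t \<notin> X k}) * F t
      = F t + (\<Sum>k<N. of_bool (t \<notin> X k) * F t)" for t
  proof -
    have "real (card {k. k < N \<and> t \<notin> X k}) = (\<Sum>k<N. of_bool (t \<notin> X k))"
      by (simp add: sum.inter_filter[symmetric] Int_def of_bool_def lessThan_def)
    then show ?thesis by (simp add: distrib_right sum_distrib_right)
  qed
  have T: "((\<lambda>t. of_bool (t \<notin> X k) * F t) has_sum (\<Sum>\<^sub>\<infinity>t\<in>- X k. F t)) UNIV" for k
  proof -
    have "F summable_on (- X k)"
      using F by (rule summable_on_subset_banach) simp
    then have "(F has_sum (\<Sum>\<^sub>\<infinity>t\<in>- X k. F t)) (- X k)" by simp
    moreover have "((\<lambda>t. of_bool (t \<notin> X k) * F t) has_sum S) UNIV \<longleftrightarrow> (F has_sum S) (- X k)" for S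
      by (rule has_sum_cong_neutral) auto
    ultimately show ?thesis by simp
  qed
  have "((\<lambda>t. \<Sum>k<N. of_bool (t \<notin> X k) * F t) has_sum (\<Sum>k<N. \<Sum>\<^sub>\<infinity>t\<in>- X k. F t)) UNIV"
    by (induction N) (auto intro!: has_sum_add T)
  then have "((\<lambda>t. F t + (\<Sum>k<N. of_bool (t \<notin> X k) * F t))
      has_sum (infsum F UNIV + (\<Sum>k<N. \<Sum>\<^sub>\<infinity>t\<in>- X k. F t))) UNIV"
    using F by (intro has_sum_add) simp
  then have hs: "((\<lambda>t. real (1 + card {k. k < N \<and> t \<notin> X k}) * F t)
      has_sum (infsum F UNIV + (\<Sum>k<N. \<Sum>\<^sub>\<infinity>t\<in>- X k. F t))) UNIV"
    unfolding eq .
  then show "(\<lambda>t. real (1 + card {k. k < N \<and> t \<notin> X k}) * F t) summable_on UNIV"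
    by (rule has_sum_imp_summable)
  have "(\<Sum>k<N. \<Sum>\<^sub>\<infinity>t\<in>- X k. F t) \<le> (\<Sum>k<N. (1 / 2 :: real) ^ k)"
    by (rule sum_mono) (rule tail)
  also have "\<dots> \<le> 2"
    by (simp add: sum_gp_strict)
  finally show "(\<Sum>\<^sub>\<infinity>t. real (1 + card {k. k < N \<and> t \<notin> X k}) * F t) \<le> infsum F UNIV + 2"
    using infsumI[OF hs] by simp
qed

lemma one_in_Bset: "1 \<in> Bset X n"
  by (simp add: Bset_def)

lemma Bset_mono: "X \<subseteq> Y \<Longrightarrow> m \<le> n \<Longrightarrow> Bset X m \<subseteq> Bset Y n"
  unfolding Bset_def by (intro Un_mono UN_mono subset_refl subsetI) (auto intro: order_trans)

lemma mem_Bset_iff: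
  "u \<in> Bset X n \<longleftrightarrow>
    (\<exists>w. length w \<le> n \<and> set w \<subseteq> X \<times> {1, -1} \<and> u \<in> foldl signed_translate {1} w)"
    (is "?L \<longleftrightarrow> ?R")
proof
  assume ?L
  then consider "u \<in> foldl signed_translate {1} []"
    | w where "length w \<le> n" "set w \<subseteq> X \<times> {1, -1}" "u \<in> foldl signed_translate {1} w"
    unfolding Bset_def by auto
  then show ?R
  proof cases
    case 1
    then show ?thesis by (intro exI[of _ "[]"]) simp
  qed (intro exI conjI)
qed (unfold Bset_def, blast)

lemma Bset_signed_step:
  assumes "u \<in> Bset X n" and "x \<in> X" and "\<epsilon> \<in> {1, -1}" and "v \<in> signed_translate {u} (x, \<epsilon>)"
  shows "v \<in> Bset X (Suc n)"
proof -
  obtain w where w: "length w \<le> n" "set w \<subseteq> X \<times> {1, -1}" "u \<in> foldl signed_translate {1} w"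
    using assms(1) unfolding mem_Bset_iff by (elim exE conjE)
  have "v \<in> foldl signed_translate {1} (w @ [(x, \<epsilon>)])"
    using assms(4) w(3)
    by (auto simp: signed_translate_def right_translate_def right_preimage_def split: if_splits)
  moreover have "length (w @ [(x, \<epsilon>)]) \<le> Suc n" "set (w @ [(x, \<epsilon>)]) \<subseteq> X \<times> {1, -1}"
    using w assms(2,3) by auto
  ultimately show ?thesis
    unfolding mem_Bset_iff by (intro exI conjI)
qed

text \<open>For an increasing sequence \<open>D\<close> this is the first index \<open>n\<close> with \<open>u \<in> D n\<close>, truncated at \<open>N\<close>. As a
  count it is also defined, and at most \<open>N\<close>, for points outside all the sets.\<close>

definition level :: "(nat \<Rightarrow> 'a set) \<Rightarrow> nat \<Rightarrow> 'a \<Rightarrow> nat" where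
  "level D N u = card {n. n < N \<and> u \<notin> D n}"

lemma level_le: "level D N u \<le> N"
proof -
  have "level D N u \<le> card {n. n < N}"
    unfolding level_def by (rule card_mono) auto
  then show ?thesis by simp
qed

text \<open>If \<open>v \<notin> D n\<close> with \<open>n > 0\<close>, then \<open>u \<notin> D (n - 1)\<close> or \<open>t \<notin> X n\<close>; the summand \<open>1\<close> accounts for \<open>n = 0\<close>.\<close>

lemma level_le_add:
  assumes "\<And>n. u \<in> D n \<Longrightarrow> t \<in> X (Suc n) \<Longrightarrow> v \<in> D (Suc n)"
  shows "level D N v \<le> level D N u + (1 + level X N t)"
proof -
  let ?A = "\<lambda>D u. {n. n < N \<and> u \<notin> D n}"
  have "?A D v \<subseteq> {0} \<union> Suc ` ?A D u \<union> ?A X t"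
  proof
    fix n assume n: "n \<in> ?A D v"
    show "n \<in> {0} \<union> Suc ` ?A D u \<union> ?A X t"
      using n assms[of "n - 1"] by (cases n) auto
  qed
  then have "card (?A D v) \<le> card ({0} \<union> Suc ` ?A D u \<union> ?A X t)"
    by (rule card_mono[rotated]) auto
  also have "\<dots> \<le> card {0::nat} + card (Suc ` ?A D u) + card (?A X t)"
    by (meson card_Un_le add_le_mono1 order_trans)
  also have "card (Suc ` ?A D u) = card (?A D u)"
    by (rule card_image) simp
  finally show ?thesis by (simp add: level_def)
qed

text \<open>The elements \<open>s\<close> and \<open>s t\<close> are joined by one signed step, in either direction, which is available
  in \<open>Bset (X n)\<close> as soon as \<open>t \<in> X n\<close>. A step along a rare \<open>t\<close>, one that enters the sets \<open>X n\<close>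
  late, may therefore change the level more.\<close>

lemma level_Bset_times:
  fixes X :: "nat \<Rightarrow> 'a::monoid_mult set"
  assumes "incseq X"
  defines "D \<equiv> \<lambda>n. Bset (X n) n"
  shows "\<bar>real (level D N (s * t)) - real (level D N s)\<bar> \<le> real (1 + level X N t)"
proof -
  have mono: "u \<in> Bset (X (Suc n)) n" if "u \<in> D n" for u n
  proof -
    have "X n \<subseteq> X (Suc n)" using assms(1) by (simp add: incseq_SucD)
    then show ?thesis using that Bset_mono[of "X n" "X (Suc n)" n n] by (auto simp: D_def)
  qed
  have "s * t \<in> D (Suc n)" if "s \<in> D n" "t \<in> X (Suc n)" for n
    unfolding D_def
    by (rule Bset_signed_step[OF mono[OF that(1)] that(2), of 1])
      (auto simp: signed_translate_def right_translate_def)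
  from level_le_add[of s D t X, OF this]
  have 1: "level D N (s * t) \<le> level D N s + (1 + level X N t)" .
  have "s \<in> D (Suc n)" if "s * t \<in> D n" "t \<in> X (Suc n)" for n
    unfolding D_def
    by (rule Bset_signed_step[OF mono[OF that(1)] that(2), of "-1"])
      (auto simp: signed_translate_def right_preimage_def)
  from level_le_add[of "s * t" D t X, OF this]
  have 2: "level D N s \<le> level D N (s * t) + (1 + level X N t)" .
  show ?thesis using 1 2 by linarith
qed

lemma generator_in_left_span:
  assumes "i \<in> {1..n}"
  shows "x i \<in> left_span x n"
  using left_span_times_generator[OF assms, of 1 x] by simp

text \<open>The sets \<open>X k\<close> exhaust the total mass of all the generators together, so that the weights of
  \<open>infsum_levels_le\<close> dominate the variation of every level function against each generator. The
  bound \<open>K\<close> depends on the coefficients in a representation of \<open>f\<close>, but not on \<open>N\<close>.\<close>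

lemma levels_bounded_on_ideal:
  fixes x :: "nat \<Rightarrow> 'a::monoid_mult l1"
  assumes gen: "\<And>i. i \<in> {1..n} \<Longrightarrow> x i \<in> augmentation_ideal"
  obtains X where "\<And>k. finite (X k)" and "incseq X"
    and "\<And>f. f \<in> left_span x n \<Longrightarrow>
      \<exists>K. \<forall>N. norm (pairing (\<lambda>u. of_nat (level (\<lambda>k. Bset (X k) k) N u)) f) \<le> K"
proof -
  define F where "F t = (\<Sum>i=1..n. norm (l1_apply (x i) t))" for t
  have "(\<lambda>t. \<Sum>i\<in>I. norm (l1_apply (x i) t)) summable_on UNIV" for I
    by (induction I rule: infinite_finite_induct)
      (auto intro!: summable_on_add l1_apply_abs_summable)
  then have F: "F summable_on UNIV"
    unfolding F_def .
  have nonneg: "0 \<le> F t" for t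
    unfolding F_def by (rule sum_nonneg) simp
  obtain X where X: "\<And>k. finite (X k)" "incseq X"
    and tail: "\<And>k. (\<Sum>\<^sub>\<infinity>t\<in>- X k. F t) \<le> (1 / 2) ^ k"
    using finite_exhaustion_tail_le[OF F nonneg] by blast
  let ?D = "\<lambda>k. Bset (X k) k"
  let ?\<phi> = "\<lambda>N u. of_nat (level ?D N u) :: complex"
  define M where "M = infsum F UNIV + 2"
  have \<phi>: "norm (?\<phi> N u) \<le> real N" for N u
    using level_le[of ?D N u] by simp
  have bound: "(\<Sum>\<^sub>\<infinity>t. norm (?\<phi> N (s * t) - ?\<phi> N s) * norm (l1_apply (x i) t)) \<le> M"
    if i: "i \<in> {1..n}" for i N s
  proof -
    have "norm (?\<phi> N (s * t) - ?\<phi> N s) \<le> real (1 + level X N t)" for t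
    proof -
      have "?\<phi> N (s * t) - ?\<phi> N s = of_real (real (level ?D N (s * t)) - real (level ?D N s))"
        by simp
      then show ?thesis
        using level_Bset_times[OF X(2), of N s t] by (simp only: norm_of_real)
    qed
    moreover have "norm (l1_apply (x i) t) \<le> F t" for t
      unfolding F_def by (rule member_le_sum[OF i]) auto
    ultimately have le: "norm (?\<phi> N (s * t) - ?\<phi> N s) * norm (l1_apply (x i) t)
        \<le> real (1 + level X N t) * F t" for t
      by (intro mult_mono) auto
    have sm: "(\<lambda>t. real (1 + level X N t) * F t) summable_on UNIV"
      unfolding level_def by (rule infsum_levels_le(1)[OF F tail])
    have "(\<lambda>t. norm (?\<phi> N (s * t) - ?\<phi> N s) * norm (l1_apply (x i) t)) summable_on UNIV"
      using abs_summable_on_comparison_test'[OF sm,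
          of "\<lambda>t. norm (?\<phi> N (s * t) - ?\<phi> N s) * norm (l1_apply (x i) t)"] le
      by simp
    then have "(\<Sum>\<^sub>\<infinity>t. norm (?\<phi> N (s * t) - ?\<phi> N s) * norm (l1_apply (x i) t))
        \<le> (\<Sum>\<^sub>\<infinity>t. real (1 + level X N t) * F t)"
      by (rule infsum_mono[OF _ sm le])
    also have "\<dots> \<le> M"
      unfolding level_def M_def by (rule infsum_levels_le(2)[OF F tail])
    finally show ?thesis .
  qed
  show ?thesis
  proof (rule that[OF X])
    fix f assume "f \<in> left_span x n"
    then obtain a where f: "f = (\<Sum>i=1..n. a i * x i)"
      by (auto simp: left_span_def)
    have "norm (pairing (?\<phi> N) f) \<le> (\<Sum>i=1..n. (\<Sum>\<^sub>\<infinity>s. norm (l1_apply (a i) s)) * M)" for N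
      unfolding f pairing_sum[of "?\<phi> N", OF \<phi>]
      by (rule sum_norm_le, rule norm_pairing_times_le[OF \<phi> gen bound]) auto
    then show "\<exists>K. \<forall>N. norm (pairing (?\<phi> N) f) \<le> K" by blast
  qed
qed

lift_definition geometric_l1 :: "nat l1" is "\<lambda>j. (1 / 2) ^ j"
proof -
  have "((\<lambda>j. norm ((1 / 2 :: complex) ^ j)) has_sum 2) UNIV"
    using geometric_sums[of "1 / 2 :: real"]
    by (intro sums_nonneg_imp_has_sum) (auto simp: norm_power norm_divide)
  then show "(\<lambda>j. (1 / 2 :: complex) ^ j) abs_summable_on UNIV"
    by (rule has_sum_imp_summable)
qed

lemma pairing_geometric_ge:
  assumes "\<And>j. c j \<le> N"
  shows "real (c i) / 2 ^ i \<le> norm (pairing (\<lambda>j. of_nat (c j)) geometric_l1)"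
proof -
  let ?r = "\<lambda>j. real (c j) * (1 / 2) ^ j"
  have "norm (of_nat (c j) :: complex) \<le> real N" for j
    using assms[of j] by simp
  from bounded_times_abs_summable[OF this l1_apply_abs_summable[of geometric_l1]]
  have sm: "?r summable_on UNIV"
    by (simp add: geometric_l1.rep_eq norm_mult norm_power norm_divide)
  have "pairing (\<lambda>j. of_nat (c j)) geometric_l1 = (\<Sum>\<^sub>\<infinity>j. of_real (?r j))"
    by (simp add: pairing_def geometric_l1.rep_eq)
  also have "\<dots> = of_real (infsum ?r UNIV)"
    using sm by (intro infsumI has_sum_of_real) simp
  finally have eq: "norm (pairing (\<lambda>j. of_nat (c j)) geometric_l1) = \<bar>infsum ?r UNIV\<bar>"
    by (simp only: norm_of_real)
  have "?r i \<le> infsum ?r UNIV"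
    using finite_sum_le_infsum[OF sm, of "{i}"] by simp
  then show ?thesis
    unfolding eq by (simp add: power_one_over)
qed

lemma finitely_generated_imp_pseudo_finite:
  assumes "finitely_generated_left_ideal (augmentation_ideal :: 'a::monoid_mult l1 set)"
  shows "pseudo_finite TYPE('a)"
proof -
  obtain n and x :: "nat \<Rightarrow> 'a l1" where I: "augmentation_ideal = left_span x n"
    using assms by (auto simp: finitely_generated_left_ideal_def left_span_def)
  have gen: "x i \<in> augmentation_ideal" if "i \<in> {1..n}" for i
    unfolding I by (rule generator_in_left_span[OF that])
  obtain X :: "nat \<Rightarrow> 'a set" where X: "\<And>k. finite (X k)" "incseq X"
    and bounded: "\<And>f. f \<in> left_span x n \<Longrightarrow>
      \<exists>K. \<forall>N. norm (pairing (\<lambda>u. of_nat (level (\<lambda>k. Bset (X k) k) N u)) f) \<le> K"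
    by (rule levels_bounded_on_ideal[of n x]) (erule gen, rule that, assumption+)
  define D where "D k = Bset (X k) k" for k
  have "\<exists>k. D k = UNIV"
  proof (rule ccontr)
    assume "\<not> ?thesis"
    \<comment> \<open>The levels of the points \<open>u j\<close> grow like \<open>4 ^ j\<close>, faster than their masses \<open>2 ^ - j\<close> decay.\<close>
    then have "\<exists>u. u \<notin> D (4 ^ j)" for j by blast
    then obtain u where u: "\<And>j. u j \<notin> D (4 ^ j)" by metis
    define g where "g = push u geometric_l1"
    have in_ideal: "g - collapse g \<in> augmentation_ideal"
      by (simp add: augmentation_ideal_iff collapse_diff collapse_idem)
    obtain K where K: "\<And>N. norm (pairing (\<lambda>u. of_nat (level D N u)) (g - collapse g)) \<le> K"
      using bounded[OF in_ideal[unfolded I]] unfolding D_def by metis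
    have "2 ^ j \<le> K" for j
    proof -
      let ?\<phi> = "\<lambda>u. of_nat (level D (4 ^ j) u) :: complex"
      have \<phi>: "norm (?\<phi> v) \<le> 4 ^ j" for v
      proof -
        have "real (level D (4 ^ j) v) \<le> real (4 ^ j)"
          using level_le by (rule of_nat_mono)
        then show ?thesis by simp
      qed
      have "u j \<notin> D m" if "m < 4 ^ j" for m
      proof -
        have "D m \<subseteq> D (4 ^ j)"
          unfolding D_def using that by (intro Bset_mono incseqD[OF X(2)]) auto
        then show ?thesis using u by blast
      qed
      then have "{n. n < 4 ^ j \<and> u j \<notin> D n} = {..<4 ^ j}" by auto
      then have uj: "level D (4 ^ j) (u j) = 4 ^ j" by (simp add: level_def)
      have "level D (4 ^ j) 1 = 0"
        by (simp add: level_def D_def one_in_Bset)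
      then have "pairing ?\<phi> (collapse g) = 0"
        unfolding collapse_def pairing_push[of ?\<phi>, OF \<phi>] by (simp add: pairing_def)
      then have "pairing ?\<phi> (g - collapse g) = pairing ?\<phi> g"
        using pairing_add[of ?\<phi>, OF \<phi>, of "g - collapse g" "collapse g"] by simp
      also have "\<dots> = pairing (\<lambda>i. of_nat (level D (4 ^ j) (u i))) geometric_l1"
        unfolding g_def by (rule pairing_push[of ?\<phi>, OF \<phi>])
      finally have "real (level D (4 ^ j) (u j)) / 2 ^ j \<le> norm (pairing ?\<phi> (g - collapse g))"
        using pairing_geometric_ge[of "\<lambda>i. level D (4 ^ j) (u i)", OF level_le] by simp
      also have "\<dots> \<le> K" by (rule K)
      also have "real (level D (4 ^ j) (u j)) / 2 ^ j = 2 ^ j"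
        by (simp add: uj power_divide[symmetric])
      finally show ?thesis .
    qed
    moreover obtain j where "K < 2 ^ j"
      using real_arch_pow[of 2 K] by auto
    ultimately show False by (meson not_le)
  qed
  then obtain k where "Bset (X k) k = UNIV" by (auto simp: D_def)
  then have "UNIV = (\<Union>i\<in>{0..k}. Bset (X k) i)" by fastforce
  then show ?thesis
    unfolding pseudo_finite_def using X(1) by blast
qed

theorem theorem1p7:
  shows "finitely_generated_left_ideal (augmentation_ideal :: 'a::monoid_mult l1 set)
    \<longleftrightarrow> pseudo_finite TYPE('a)"
  using finitely_generated_imp_pseudo_finite pseudo_finite_imp_finitely_generated by blast

end
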